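(* Let $f:\mathbb{R}^n\to\mathbb{R}$ be convex and differentiable with $L$-Lipschitz continuous gradient ($L>0$), let $g:\mathbb{R}^n\to\mathbb{R}\cup\{+\infty\}$ be proper, lower semicontinuous and convex, let $F=f+g$, and suppose $\min F>-\infty$. Let $\theta>1$, $0<c<1$, and for $k\ge 1$ set $$\beta_k=\frac{1}{(k+1)^\theta},\qquad \gamma_k=\frac{2(1-\beta_k)c}{L}.$$ Let $(x^k)_{k\ge 0}$ be generated by the proximal inertial gradient descent $$x^{k+1}=\mathbf{prox}_{\gamma_k g}\left[x^k-\gamma_k\nabla f(x^k)+\beta_k(x^k-x^{k-1})\right],\qquad k\ge 1,$$ from given initial points $x^0,x^1\in\mathbb{R}^n$. Then $$F(x^k)-\min F=O\left(\frac1k\right)\quad\text{as }k\to\infty.$$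
   Context: $\|\cdot\|$ is the Euclidean norm; $\mathbf{prox}_{\gamma g}(y)=\arg\min_z\{g(z)+\frac{1}{2\gamma}\|z-y\|^2\}$. $\min F$ denotes the minimum value of $F$, attained on the nonempty set $\arg\min F$. $F$ is not assumed coercive. *)

theory Defs
  imports "HOL-Analysis.Analysis" "HOL-Library.Landau_Symbols"
begin

text \<open>
  Functions with values in \<open>\<real> \<union> {+\<infinity>}\<close> are modelled as functions into \<open>ereal\<close> that
  avoid \<open>-\<infinity>\<close>; this exclusion is part of properness.
\<close>

definition proper_fun :: "('a \<Rightarrow> ereal) \<Rightarrow> bool" where
  "proper_fun g \<longleftrightarrow> (\<forall>z. g z \<noteq> -\<infinity>) \<and> (\<exists>z. g z \<noteq> \<infinity>)"

definition lsc_fun :: "('a::topological_space \<Rightarrow> ereal) \<Rightarrow> bool" where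
  "lsc_fun g \<longleftrightarrow> (\<forall>z. g z \<le> Liminf (at z) g)"

text \<open>
  For \<open>u = 0\<close> or \<open>v = 0\<close> the convention \<open>0 * \<infinity> = 0\<close> of \<open>ereal\<close> makes the inequality trivial.
\<close>

definition convex_fun :: "('a::real_vector \<Rightarrow> ereal) \<Rightarrow> bool" where
  "convex_fun g \<longleftrightarrow> (\<forall>y z. \<forall>u\<ge>0. \<forall>v\<ge>0. u + v = 1 \<longrightarrow>
     g (u *\<^sub>R y + v *\<^sub>R z) \<le> ereal u * g y + ereal v * g z)"

text \<open>
  \<open>arg_min\<close> selects some minimizer. For \<open>\<gamma> > 0\<close> and \<open>g\<close> proper, lower semicontinuous and
  convex on a Euclidean space, the minimizer exists and is unique, so this is the usual
  proximal operator.
\<close>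

definition prox :: "real \<Rightarrow> ('a::real_normed_vector \<Rightarrow> ereal) \<Rightarrow> 'a \<Rightarrow> 'a" where
  "prox \<gamma> g y = arg_min (\<lambda>z. g z + ereal (1 / (2 * \<gamma>) * (norm (z - y))\<^sup>2)) (\<lambda>_. True)"

definition argmin_set :: "('a \<Rightarrow> ereal) \<Rightarrow> 'a set" where
  "argmin_set F = {z. is_arg_min F (\<lambda>_. True) z}"

text \<open>The infimum of \<open>F\<close>; it is the minimum of \<open>F\<close> when \<open>argmin_set F\<close> is nonempty.\<close>

definition min_value :: "('a \<Rightarrow> ereal) \<Rightarrow> ereal" where
  "min_value F = (INF z. F z)"

end

theory Submission
  imports Defs
begin

text \<open>
  The proximal gradient inequality is used twice. Comparing with the current iterate shows that
  \<open>\<xi>\<^sub>k = F (x\<^sub>k) - min F + \<beta>\<^sub>k / (2 \<gamma>\<^sub>k) \<parallel>x\<^sub>k - x\<^sub>k\<^sub>-\<^sub>1\<parallel>\<^sup>2\<close> decreases by at least a multiple of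
  \<open>\<parallel>x\<^sub>k\<^sub>+\<^sub>1 - x\<^sub>k\<parallel>\<^sup>2\<close>, so the squared steps are summable. Comparing with a minimizer gives a quasi-Fejer
  inequality for the squared distance to it; as \<open>\<theta> > 1\<close> makes \<open>\<beta>\<close> summable, no coercivity is needed to
  bound this distance, and the gaps \<open>F (x\<^sub>k) - min F\<close> are summable. Hence \<open>\<xi>\<close> is nonnegative,
  decreasing and summable, and therefore \<open>O (1 / k)\<close>.
\<close>

section \<open>Lower semicontinuity, attained minima and linear minorants\<close>

lemma lsc_fun_open_superlevel:
  fixes g :: "'a::topological_space \<Rightarrow> ereal"
  assumes "lsc_fun g"
  shows "open {z. a < g z}"
proof (subst open_subopen, intro ballI)
  fix z assume "z \<in> {z. a < g z}"
  then have "a < g z" by simp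
  also have "g z \<le> Liminf (at z) g"
    using assms by (simp add: lsc_fun_def)
  \<comment> \<open>The filter \<open>at z\<close> leaves out \<open>z\<close> itself; the
    inequality \<open>a < g z\<close> supplies the missing point.\<close>
  finally have "eventually (\<lambda>w. a < g w) (at z)" by (rule less_LiminfD)
  with \<open>a < g z\<close> have "eventually (\<lambda>w. a < g w) (nhds z)"
    by (simp add: eventually_nhds_conv_at)
  then show "\<exists>T. open T \<and> z \<in> T \<and> T \<subseteq> {z. a < g z}"
    by (auto simp: eventually_nhds)
qed

text \<open>Without a minimum, the open sets \<open>{z. h w < h z}\<close> with \<open>w\<close> in
  \<open>K\<close> cover \<open>K\<close>. In a finite subcover, a centre with least value lies in
  none of the covering sets.\<close>

lemma compact_attains_min:
  fixes h :: "'a::topological_space \<Rightarrow> 'b::linorder"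
  assumes "compact K" "K \<noteq> {}" "\<And>a. open {z. a < h z}"
  obtains z where "z \<in> K" "\<And>w. w \<in> K \<Longrightarrow> h z \<le> h w"
proof (rule ccontr)
  assume "\<not> thesis"
  then have "\<And>z. z \<in> K \<Longrightarrow> \<exists>w\<in>K. h w < h z" using that by (meson not_le)
  then have "K \<subseteq> (\<Union>w\<in>K. {z. h w < h z})" by auto
  then obtain C where C: "C \<subseteq> K" "finite C" "K \<subseteq> (\<Union>w\<in>C. {z. h w < h z})"
    using compactE_image[OF assms(1), of K "\<lambda>w. {z. h w < h z}"] assms(3) by metis
  with assms(2) have "C \<noteq> {}" by auto
  with C(2) obtain w where w: "w \<in> C" "\<And>v. v \<in> C \<Longrightarrow> h w \<le> h v"
    using ex_is_arg_min_if_finite[of C h] by (metis is_arg_min_linorder)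
  with C show False by (force simp: not_less[symmetric])
qed

text \<open>A margin below the sum at \<open>z\<close> is split in two: a threshold
  \<open>b'\<close> that \<open>g\<close> exceeds nearby, and a complementary threshold
  \<open>b - b'\<close> for \<open>q\<close>, so that the sum stays above
  \<open>b > a\<close>.\<close>

lemma lsc_fun_add_continuous:
  fixes g :: "'a::topological_space \<Rightarrow> ereal" and q :: "'a \<Rightarrow> real"
  assumes "lsc_fun g" "\<And>z. g z \<noteq> -\<infinity>" "continuous_on UNIV q"
  shows "open {z. a < g z + ereal (q z)}"
proof (subst open_subopen, intro ballI)
  fix z assume "z \<in> {z. a < g z + ereal (q z)}"
  then obtain b where b: "a < ereal b" "ereal b < g z + ereal (q z)"
    using ereal_dense2 by blast
  then have "ereal (b - q z) < g z" by (cases "g z") auto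
  then obtain b' where b': "ereal (b - q z) < ereal b'" "ereal b' < g z"
    using ereal_dense2 by blast
  let ?T = "{w. ereal b' < g w} \<inter> {w. b - b' < q w}"
  have "open ?T"
    using assms by (intro open_Int lsc_fun_open_superlevel open_Collect_less continuous_intros)
  moreover have "z \<in> ?T" using b' by auto
  moreover have "?T \<subseteq> {z. a < g z + ereal (q z)}"
  proof
    fix w assume "w \<in> ?T"
    then have "ereal b < g w + ereal (q w)" by (cases "g w") auto
    with b(1) show "w \<in> {z. a < g z + ereal (q z)}" by auto
  qed
  ultimately show "\<exists>T. open T \<and> z \<in> T \<and> T \<subseteq> {z. a < g z + ereal (q z)}" by blast
qed

text \<open>
  Compactness bounds \<open>g\<close> from below on a unit ball around a point of its domain, and
  convexity propagates this bound along rays.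
\<close>

lemma convex_lsc_linear_minorant:
  fixes g :: "'a::euclidean_space \<Rightarrow> ereal"
  assumes "proper_fun g" "lsc_fun g" "convex_fun g"
  obtains A B :: real where "B \<ge> 0" "\<And>z. ereal (A - B * norm (z - y)) \<le> g z"
proof -
  have ninf: "g z \<noteq> -\<infinity>" for z using assms(1) by (simp add: proper_fun_def)
  obtain z0 where "g z0 \<noteq> \<infinity>" using assms(1) by (auto simp: proper_fun_def)
  with ninf[of z0] obtain r where r: "g z0 = ereal r" by (cases "g z0") auto
  obtain w0 where w0: "w0 \<in> cball z0 1" "\<And>w. w \<in> cball z0 1 \<Longrightarrow> g w0 \<le> g w"
    using compact_attains_min[of "cball z0 1" g] lsc_fun_open_superlevel[OF assms(2)] by auto
  from w0(2)[of z0] r ninf[of w0] obtain m where m: "g w0 = ereal m" "m \<le> r"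
    by (cases "g w0") auto
  have bound: "ereal (m - (r - m) * norm (z - z0)) \<le> g z" for z
  proof (cases "norm (z - z0) \<le> 1")
    case True
    then have "ereal m \<le> g z" using w0(2)[of z] m by (simp add: dist_norm norm_minus_commute)
    moreover have "m - (r - m) * norm (z - z0) \<le> m" using m by simp
    ultimately show ?thesis by (meson ereal_less_eq(3) order_trans)
  next
    case False
    define s where "s = norm (z - z0)"
    \<comment> \<open>The point where the ray from \<open>z0\<close> through \<open>z\<close> meets
      the unit sphere around \<open>z0\<close>. There \<open>g\<close> is at least \<open>m\<close>,
      and convexity solved for \<open>g z\<close> gives the slope \<open>r - m\<close>.\<close>
    define w where "w = (1 - 1 / s) *\<^sub>R z0 + (1 / s) *\<^sub>R z"
    have s: "s > 1" using False by (simp add: s_def)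
    have "w - z0 = (1 / s) *\<^sub>R (z - z0)" by (simp add: w_def algebra_simps)
    then have "norm (w - z0) = 1 / s * s" using s by (simp flip: s_def)
    then have "norm (w - z0) = 1" using s by simp
    then have "ereal m \<le> g w" using w0(2)[of w] m by (simp add: dist_norm norm_minus_commute)
    also have "g w \<le> ereal (1 - 1 / s) * g z0 + ereal (1 / s) * g z"
      using assms(3) s unfolding convex_fun_def w_def by (auto simp: divide_simps)
    finally have *: "ereal m \<le> ereal ((1 - 1 / s) * r) + ereal (1 / s) * g z" by (simp add: r)
    show ?thesis
    proof (cases "g z")
      case (real gz)
      with * have "m \<le> (1 - 1 / s) * r + (1 / s) * gz" by simp
      with s have "m * s \<le> ((1 - 1 / s) * r + (1 / s) * gz) * s" by simp
      also have "\<dots> = (s - 1) * r + gz" using s by (simp add: field_simps)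
      finally show ?thesis using m(2) real by (simp add: s_def[symmetric] algebra_simps)
    qed (use ninf in auto)
  qed
  show thesis
  \<comment> \<open>The triangle inequality moves the centre of the bound from \<open>z0\<close> to
    \<open>y\<close>, at the cost of a constant.\<close>
  proof (rule that[of "r - m" "m - (r - m) * norm (y - z0)"])
    fix z
    have "norm (z - z0) \<le> norm (z - y) + norm (y - z0)"
      using norm_triangle_ineq[of "z - y" "y - z0"] by simp
    then have "(r - m) * norm (z - z0) \<le> (r - m) * (norm (z - y) + norm (y - z0))"
      using m by (intro mult_left_mono) auto
    then have "m - (r - m) * norm (y - z0) - (r - m) * norm (z - y) \<le> m - (r - m) * norm (z - z0)"
      by (simp add: algebra_simps)
    then show "ereal (m - (r - m) * norm (y - z0) - (r - m) * norm (z - y)) \<le> g z"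
      using bound[of z] by (meson ereal_less_eq(3) order_trans)
  qed (use m in simp)
qed

section \<open>The proximal operator and its optimality condition\<close>

lemma prox_le:
  fixes g :: "'a::euclidean_space \<Rightarrow> ereal"
  assumes g: "proper_fun g" "lsc_fun g" "convex_fun g" and "\<gamma> > 0"
  shows "g (prox \<gamma> g y) + ereal (1 / (2 * \<gamma>) * (norm (prox \<gamma> g y - y))\<^sup>2)
           \<le> g z + ereal (1 / (2 * \<gamma>) * (norm (z - y))\<^sup>2)"
proof -
  define q where "q = 1 / (2 * \<gamma>)"
  have q: "q > 0" using assms by (simp add: q_def)
  define h where "h z = g z + ereal (q * (norm (z - y))\<^sup>2)" for z
  have ninf: "g z \<noteq> -\<infinity>" for z using g(1) by (simp add: proper_fun_def)
  obtain z0 where "g z0 \<noteq> \<infinity>" using g(1) by (auto simp: proper_fun_def)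
  with ninf[of z0] obtain H where H: "h z0 = ereal H" by (cases "g z0") (auto simp: h_def)
  obtain A B where AB: "B \<ge> 0" "\<And>z. ereal (A - B * norm (z - y)) \<le> g z"
    using convex_lsc_linear_minorant[OF g] by blast
  \<comment> \<open>Beyond radius \<open>R\<close> the quadratic beats the linear minorant:
    \<open>s > (B + 1) / q\<close> gives \<open>A - B * s + q * s\<^sup>2 \<ge> A + s\<close>, and
    \<open>s > H - A\<close> puts this above \<open>H\<close>. Minimizing over the compact ball is
    then global.\<close>
  define R where "R = max ((B + 1) / q) (H - A)"
  have far: "h z0 < h z" if "z \<notin> cball y R" for z
  proof -
    define s where "s = norm (z - y)"
    have s: "s > (B + 1) / q" "s > H - A"
      using that by (auto simp: R_def s_def dist_norm norm_minus_commute)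
    have "(B + 1) / q > 0" using AB(1) q by simp
    then have "s > 0" using s by linarith
    have "B + 1 < q * s" using s(1) q by (simp add: field_simps)
    then have "s * (B + 1) \<le> s * (q * s)" using \<open>s > 0\<close> by simp
    then have "H < A - B * s + q * s\<^sup>2" using s(2) by (simp add: algebra_simps power2_eq_square)
    moreover have "ereal (A - B * s + q * s\<^sup>2) \<le> h z"
      using add_right_mono[OF AB(2)[of z], of "ereal (q * s\<^sup>2)"] by (simp add: h_def s_def)
    ultimately show ?thesis unfolding H by (meson ereal_less(2) less_ereal.simps(1) less_le_trans)
  qed
  have opn: "open {z. a < h z}" for a
    unfolding h_def by (intro lsc_fun_add_continuous g ninf continuous_intros)
  have z0: "z0 \<in> cball y R" using far[of z0] by blast
  obtain p where p: "p \<in> cball y R" "\<And>w. w \<in> cball y R \<Longrightarrow> h p \<le> h w"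
  proof (rule compact_attains_min[of "cball y R" h])
    show "cball y R \<noteq> {}" using z0 by blast
  qed (use opn in auto)
  have "h p \<le> h w" for w
    using p(2)[of w] p(2)[OF z0] far[of w] by (cases "w \<in> cball y R") auto
  \<comment> \<open>One minimizer is enough for the choice inside \<open>arg_min\<close> to return a
    minimizer.\<close>
  then have "is_arg_min h (\<lambda>_. True) p" by (simp add: is_arg_min_linorder)
  then have "is_arg_min h (\<lambda>_. True) (arg_min h (\<lambda>_. True))"
    unfolding arg_min_def by (rule someI)
  moreover have "prox \<gamma> g y = arg_min h (\<lambda>_. True)"
    by (simp add: prox_def h_def[abs_def] q_def)
  ultimately have "h (prox \<gamma> g y) \<le> h z" by (simp add: is_arg_min_linorder)
  then show ?thesis by (simp add: h_def q_def)
qed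

lemma prox_finite:
  fixes g :: "'a::euclidean_space \<Rightarrow> ereal"
  assumes g: "proper_fun g" "lsc_fun g" "convex_fun g" and "\<gamma> > 0"
  shows "g (prox \<gamma> g y) \<noteq> \<infinity>"
proof -
  obtain z where "g z \<noteq> \<infinity>" using g(1) by (auto simp: proper_fun_def)
  then show ?thesis using prox_le[OF assms, of y z] by auto
qed

text \<open>Expresses that \<open>(y - p) / \<gamma>\<close> is a subgradient of \<open>g\<close> at
  \<open>p\<close>. Minimality of \<open>p\<close> is tested against \<open>(1 - t) p + t z\<close>;
  after division by \<open>t\<close>, the quadratic remainder vanishes as \<open>t\<close> tends to
  0 from the right.\<close>

lemma prox_variational_ineq:
  fixes g :: "'a::euclidean_space \<Rightarrow> ereal" and y :: 'a
  assumes g: "proper_fun g" "lsc_fun g" "convex_fun g" and "\<gamma> > 0" and z: "g z \<noteq> \<infinity>"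
  defines "p \<equiv> prox \<gamma> g y"
  shows "real_of_ereal (g p) \<le> real_of_ereal (g z) + (1 / \<gamma>) * ((p - y) \<bullet> (z - p))"
proof -
  have ninf: "g w \<noteq> -\<infinity>" for w using g(1) by (simp add: proper_fun_def)
  obtain a where a: "g z = ereal a" using z ninf[of z] by (cases "g z") auto
  obtain b where b: "g p = ereal b"
    using prox_finite[OF g \<open>\<gamma> > 0\<close>] ninf[of p] by (cases "g p") (auto simp: p_def)
  define q where "q = 1 / (2 * \<gamma>)"
  have ineq: "b - a - 2 * q * ((p - y) \<bullet> (z - p)) \<le> t * (q * (norm (z - p))\<^sup>2)"
    if t: "0 < t" "t < 1" for t
  proof -
    define w where "w = (1 - t) *\<^sub>R p + t *\<^sub>R z"
    have "g w \<le> ereal (1 - t) * g p + ereal t * g z"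
      using g(3) t unfolding convex_fun_def w_def by (auto simp: divide_simps)
    then have gw: "g w \<le> ereal ((1 - t) * b + t * a)" by (simp add: a b)
    have "w - y = (p - y) + t *\<^sub>R (z - p)" by (simp add: w_def algebra_simps)
    then have nw: "(norm (w - y))\<^sup>2 = (norm (p - y))\<^sup>2 + 2 * t * ((p - y) \<bullet> (z - p)) + t\<^sup>2 * (norm (z - p))\<^sup>2"
      by (simp only: power2_norm_eq_inner)
         (simp add: inner_simps inner_commute power2_eq_square algebra_simps)
    have "ereal (b + q * (norm (p - y))\<^sup>2) \<le> g w + ereal (q * (norm (w - y))\<^sup>2)"
      using prox_le[OF g \<open>\<gamma> > 0\<close>, of y w] by (simp add: p_def[symmetric] b q_def)
    also have "\<dots> \<le> ereal ((1 - t) * b + t * a) + ereal (q * (norm (w - y))\<^sup>2)"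
      using gw by (rule add_right_mono)
    finally have "b + q * (norm (p - y))\<^sup>2 \<le> (1 - t) * b + t * a + q * (norm (w - y))\<^sup>2" by simp
    then have "t * (b - a - 2 * q * ((p - y) \<bullet> (z - p))) \<le> t * (t * (q * (norm (z - p))\<^sup>2))"
      unfolding nw by (simp add: algebra_simps power2_eq_square)
    then show ?thesis using t by simp
  qed
  have "((\<lambda>t. t * (q * (norm (z - p))\<^sup>2)) \<longlongrightarrow> 0 * (q * (norm (z - p))\<^sup>2)) (at_right 0)"
    by (intro tendsto_intros)
  moreover have "eventually (\<lambda>t. b - a - 2 * q * ((p - y) \<bullet> (z - p)) \<le> t * (q * (norm (z - p))\<^sup>2)) (at_right 0)"
    unfolding eventually_at_right_field using ineq by (intro exI[of _ 1]) auto
  ultimately have "b - a - 2 * q * ((p - y) \<bullet> (z - p)) \<le> 0 * (q * (norm (z - p))\<^sup>2)"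
    by (rule tendsto_lowerbound) simp
  then show ?thesis by (simp add: a b q_def)
qed

section \<open>First-order bounds for the smooth part and the proximal gradient inequality\<close>

lemma GDERIV_imp_DERIV_line:
  assumes "GDERIV f (u + t *\<^sub>R e) :> D"
  shows "((\<lambda>t. f (u + t *\<^sub>R e)) has_real_derivative D \<bullet> e) (at t)"
proof -
  have "((\<lambda>t. u + t *\<^sub>R e) has_derivative (\<lambda>h. h *\<^sub>R e)) (at t)"
    by (auto intro!: derivative_eq_intros)
  then have "((\<lambda>t. f (u + t *\<^sub>R e)) has_derivative (\<lambda>h. (h *\<^sub>R e) \<bullet> D)) (at t)"
    by (rule has_derivative_compose) (use assms in \<open>simp add: gderiv_def\<close>)
  then show ?thesis
    by (simp add: has_field_derivative_def inner_commute mult_commute_abs)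
qed

text \<open>Restriction to the line from \<open>u\<close> through \<open>z\<close> reduces this to
  the tangent inequality for a convex function of one real variable, taken at 0 and evaluated at
  1.\<close>

lemma convex_above_gradient:
  assumes "convex_on UNIV f" "GDERIV f u :> D"
  shows "f u + D \<bullet> (z - u) \<le> f z"
proof -
  let ?\<phi> = "\<lambda>t::real. f (u + t *\<^sub>R (z - u))"
  have "convex_on UNIV ?\<phi>"
  proof
    fix t a b :: real assume "0 < t" "t < 1"
    have "u + ((1 - t) * a + t * b) *\<^sub>R (z - u)
        = (1 - t) *\<^sub>R (u + a *\<^sub>R (z - u)) + t *\<^sub>R (u + b *\<^sub>R (z - u))"
      by (simp add: algebra_simps)
    then show "?\<phi> ((1 - t) *\<^sub>R a + t *\<^sub>R b) \<le> (1 - t) * ?\<phi> a + t * ?\<phi> b"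
      using convex_onD[OF assms(1)] \<open>0 < t\<close> \<open>t < 1\<close> by simp
  qed simp
  moreover have "(?\<phi> has_real_derivative D \<bullet> (z - u)) (at 0)"
    using assms(2) by (intro GDERIV_imp_DERIV_line) simp
  ultimately have "?\<phi> 1 - ?\<phi> 0 \<ge> (D \<bullet> (z - u)) * (1 - 0)"
    by (intro convex_on_imp_above_tangent[where A = UNIV]) auto
  then show ?thesis by simp
qed

lemma lipschitz_gradient_upper_bound:
  assumes "\<And>z. GDERIV f z :> G z" "L-lipschitz_on UNIV G"
  shows "f p \<le> f u + G u \<bullet> (p - u) + L / 2 * (norm (p - u))\<^sup>2"
proof -
  define e where "e = p - u"
  \<comment> \<open>The difference of the two sides along the segment, up to the constant
    \<open>f u\<close>. Cauchy-Schwarz and the Lipschitz bound make its derivative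
    nonpositive.\<close>
  define \<phi> where "\<phi> t = f (u + t *\<^sub>R e) - t * (G u \<bullet> e) - L / 2 * t\<^sup>2 * (norm e)\<^sup>2" for t
  have "\<phi> 1 \<le> \<phi> 0"
  proof (rule DERIV_nonpos_imp_nonincreasing[where f = \<phi>])
    fix t :: real assume t: "0 \<le> t" "t \<le> 1"
    have "(\<phi> has_real_derivative G (u + t *\<^sub>R e) \<bullet> e - G u \<bullet> e - L * t * (norm e)\<^sup>2) (at t)"
      unfolding \<phi>_def
      by (rule derivative_eq_intros GDERIV_imp_DERIV_line assms(1) refl | simp)+
    moreover have "G (u + t *\<^sub>R e) \<bullet> e - G u \<bullet> e \<le> L * t * (norm e)\<^sup>2"
    proof -
      have "(G (u + t *\<^sub>R e) - G u) \<bullet> e \<le> norm (G (u + t *\<^sub>R e) - G u) * norm e"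
        by (rule norm_cauchy_schwarz)
      also have "norm (G (u + t *\<^sub>R e) - G u) \<le> L * (t * norm e)"
        using lipschitz_onD[OF assms(2), of "u + t *\<^sub>R e" u] t by (simp add: dist_norm)
      finally show ?thesis
        by (simp add: inner_diff_left power2_eq_square mult_right_mono mult.assoc)
    qed
    ultimately show "\<exists>y. (\<phi> has_real_derivative y) (at t) \<and> y \<le> 0" by fastforce
  qed simp
  then show ?thesis by (simp add: \<phi>_def e_def)
qed

text \<open>Sum of the optimality condition for \<open>p\<close>, the quadratic upper bound from
  \<open>u\<close> to \<open>p\<close>, and convexity of \<open>f\<close> from \<open>u\<close> to
  \<open>z\<close>; the terms in \<open>G u\<close> cancel. The shift \<open>v\<close> is the
  inertial term, and \<open>z\<close> stays free for the two comparisons made later.\<close>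

lemma prox_gradient_step:
  fixes g :: "'a::euclidean_space \<Rightarrow> ereal" and u v :: 'a
  assumes f: "convex_on UNIV f" "\<And>z. GDERIV f z :> G z" "L-lipschitz_on UNIV G"
    and g: "proper_fun g" "lsc_fun g" "convex_fun g" and "\<gamma> > 0" and z: "g z \<noteq> \<infinity>"
  defines "p \<equiv> prox \<gamma> g (u - \<gamma> *\<^sub>R G u + v)"
  shows "f p + real_of_ereal (g p) \<le> f z + real_of_ereal (g z)
           + (1 / \<gamma>) * ((p - u - v) \<bullet> (z - p)) + L / 2 * (norm (p - u))\<^sup>2"
proof -
  have "real_of_ereal (g p) \<le> real_of_ereal (g z)
      + (1 / \<gamma>) * ((p - (u - \<gamma> *\<^sub>R G u + v)) \<bullet> (z - p))"
    unfolding p_def by (rule prox_variational_ineq[OF g \<open>\<gamma> > 0\<close> z])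
  also have "(1 / \<gamma>) * ((p - (u - \<gamma> *\<^sub>R G u + v)) \<bullet> (z - p))
      = (1 / \<gamma>) * ((p - u - v) \<bullet> (z - p)) + G u \<bullet> (z - p)"
    using \<open>\<gamma> > 0\<close> by (simp add: inner_simps field_simps)
  finally have "real_of_ereal (g p) \<le> real_of_ereal (g z)
      + (1 / \<gamma>) * ((p - u - v) \<bullet> (z - p)) + G u \<bullet> (z - p)" by simp
  moreover have "f p \<le> f u + G u \<bullet> (p - u) + L / 2 * (norm (p - u))\<^sup>2"
    by (rule lipschitz_gradient_upper_bound[OF f(2,3)])
  moreover have "f u + G u \<bullet> (z - u) \<le> f z"
    by (rule convex_above_gradient[OF f(1) f(2)])
  ultimately show ?thesis by (simp add: inner_simps)
qed

section \<open>Summability criteria for real sequences\<close>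

lemma summable_telescope_le:
  fixes s v :: "nat \<Rightarrow> real"
  assumes "\<And>n. 0 \<le> s n" "\<And>n. 0 \<le> v n" "\<And>n. s n \<le> v n - v (Suc n)"
  shows "summable s"
proof (rule summableI_nonneg_bounded)
  fix n
  have "(\<Sum>i<n. s i) \<le> (\<Sum>i<n. v i - v (Suc i))" by (intro sum_mono assms)
  also have "\<dots> = v 0 - v n" by (rule sum_lessThan_telescope')
  finally show "(\<Sum>i<n. s i) \<le> v 0" using assms(2)[of n] by simp
qed (rule assms)

text \<open>A discrete Gronwall argument first bounds \<open>u\<close> by a constant
  \<open>B\<close>. The factor \<open>1 - b n\<close> then costs at most the summable error
  \<open>B * b n\<close>, and the remaining inequality telescopes.\<close>

lemma summable_quasi_Fejer:
  fixes b s u w :: "nat \<Rightarrow> real"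
  assumes b: "\<And>n. 0 \<le> b n" "\<And>n. b n \<le> 1 / 2" "summable b"
    and s: "\<And>n. 0 \<le> s n" "summable s"
    and u: "\<And>n. 0 \<le> u n" and w: "\<And>n. 0 \<le> w n"
    and step: "\<And>n. (1 - b n) * u (Suc n) + w n \<le> u n + s n"
  shows "summable w"
proof -
  have u_exp: "u n \<le> exp (2 * (\<Sum>i<n. b i)) * (u 0 + (\<Sum>i<n. s i))" for n
  proof (induction n)
    case (Suc n)
    \<comment> \<open>For \<open>b n \<le> 1 / 2\<close>, the factor \<open>1 + 2 * b n\<close>
      dominates the inverse of \<open>1 - b n\<close>, and is itself at most
      \<open>exp (2 * b n)\<close>.\<close>
    have "1 \<le> (1 + 2 * b n) * (1 - b n)"
      using mult_left_mono[OF b(2)[of n] b(1)[of n]] by (simp add: algebra_simps)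
    then have "u (Suc n) \<le> (1 + 2 * b n) * (1 - b n) * u (Suc n)"
      using mult_right_mono[OF _ u[of "Suc n"]] by fastforce
    also have "\<dots> \<le> (1 + 2 * b n) * (u n + s n)"
      using step[of n] w[of n] b(1)[of n] unfolding mult.assoc by (intro mult_left_mono) auto
    also have "\<dots> \<le> exp (2 * b n) * (u n + s n)"
      using exp_ge_add_one_self[of "2 * b n"] u s(1) by (intro mult_right_mono) auto
    also have "u n + s n \<le> exp (2 * (\<Sum>i<n. b i)) * (u 0 + (\<Sum>i<n. s i))
        + exp (2 * (\<Sum>i<n. b i)) * s n"
      using mult_right_mono[of 1 "exp (2 * (\<Sum>i<n. b i))" "s n"] b(1) s(1)
      by (intro add_mono Suc.IH) (simp add: sum_nonneg)
    finally show ?case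
      by (simp add: exp_add algebra_simps)
  qed simp
  define B where "B = exp (2 * suminf b) * (u 0 + suminf s)"
  have u_le: "u n \<le> B" for n
  proof -
    have "exp (2 * (\<Sum>i<n. b i)) * (u 0 + (\<Sum>i<n. s i)) \<le> B"
      unfolding B_def using b s u
      by (intro mult_mono) (auto intro!: sum_le_suminf add_nonneg_nonneg sum_nonneg)
    with u_exp[of n] show ?thesis by simp
  qed
  show ?thesis
  proof (rule summableI_nonneg_bounded)
    fix n
    have "w i \<le> (u i - u (Suc i)) + (s i + B * b i)" for i
      using step[of i] mult_left_mono[OF u_le[of "Suc i"] b(1)[of i]] by (simp add: algebra_simps)
    then have "(\<Sum>i<n. w i) \<le> (\<Sum>i<n. (u i - u (Suc i)) + (s i + B * b i))" by (intro sum_mono)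
    also have "\<dots> = u 0 - u n + (\<Sum>i<n. s i + B * b i)"
      by (simp only: sum.distrib[of "\<lambda>i. u i - u (Suc i)"] sum_lessThan_telescope')
    also have "\<dots> \<le> u 0 + (\<Sum>i. s i + B * b i)"
      using u[of n] u[of 0] u_le[of 0] b s
      by (intro add_mono sum_le_suminf) (auto intro!: summable_add summable_mult add_nonneg_nonneg mult_nonneg_nonneg)
    finally show "(\<Sum>i<n. w i) \<le> u 0 + (\<Sum>i. s i + B * b i)" .
  qed (rule w)
qed

text \<open>Each of the first \<open>n\<close> terms is at least \<open>v n\<close>.\<close>

lemma decseq_summable_bound:
  fixes v :: "nat \<Rightarrow> real"
  assumes "decseq v" "\<And>n. 0 \<le> v n" "summable v"
  shows "real n * v n \<le> suminf v"
proof -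
  have "real n * v n = (\<Sum>i<n. v n)" by simp
  also have "\<dots> \<le> (\<Sum>i<n. v i)" using assms(1) by (intro sum_mono) (simp add: decseqD)
  also have "\<dots> \<le> suminf v" using assms by (intro sum_le_suminf) auto
  finally show ?thesis .
qed

lemma inner_le_half_sum_norms:
  fixes a b :: "'a::real_inner"
  shows "a \<bullet> b \<le> ((norm a)\<^sup>2 + (norm b)\<^sup>2) / 2"
proof -
  have "0 \<le> (norm (a - b))\<^sup>2" by simp
  then show ?thesis by (simp add: power2_norm_eq_inner inner_simps inner_commute)
qed

theorem theorem2:
  fixes f :: "real ^ 'n \<Rightarrow> real"
    and grad_f :: "real ^ 'n \<Rightarrow> real ^ 'n"
    and g F :: "real ^ 'n \<Rightarrow> ereal"
    and L \<theta> c :: real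
    and \<beta> \<gamma> :: "nat \<Rightarrow> real"
    and x :: "nat \<Rightarrow> real ^ 'n"
  assumes "convex_on UNIV f"
    and "\<forall>z. GDERIV f z :> grad_f z"
    and "L > 0"
    and "L-lipschitz_on UNIV grad_f"
    and "proper_fun g" and "lsc_fun g" and "convex_fun g"
    and "\<forall>z. F z = ereal (f z) + g z"
    and "argmin_set F \<noteq> {}"
    and "min_value F > -\<infinity>"
    and "\<theta> > 1" and "0 < c" and "c < 1"
    and "\<forall>k\<ge>1. \<beta> k = 1 / (real k + 1) powr \<theta>"
    and "\<forall>k\<ge>1. \<gamma> k = 2 * (1 - \<beta> k) * c / L"
    and "\<forall>k\<ge>1. x (k + 1) =
           prox (\<gamma> k) g (x k - \<gamma> k *\<^sub>R grad_f (x k) + \<beta> k *\<^sub>R (x k - x (k - 1)))"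
  shows "(\<forall>\<^sub>F k in sequentially. F (x k) \<noteq> \<infinity>) \<and>
         (\<lambda>k. real_of_ereal (F (x k) - min_value F)) \<in> O(\<lambda>k. 1 / real k)"
proof -

  \<comment> \<open>The minimum value and the real-valued gap\<close>
  have g: "proper_fun g" "lsc_fun g" "convex_fun g" by fact+
  have grad: "\<And>z. GDERIV f z :> grad_f z" using assms(2) by blast
  have L: "L > 0" and c: "0 < c" "c < 1" by fact+
  have ninf: "g z \<noteq> -\<infinity>" for z using g(1) by (simp add: proper_fun_def)
  obtain xs where "xs \<in> argmin_set F" using assms(9) by blast
  then have xs: "F xs \<le> F z" for z by (simp add: argmin_set_def is_arg_min_linorder)
  obtain z0 where z0: "g z0 \<noteq> \<infinity>" using g(1) by (auto simp: proper_fun_def)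
  have gxs: "g xs \<noteq> \<infinity>" using xs[of z0] z0 ninf[of z0] assms(8) by (cases "g z0") auto
  have real_g: "ereal (real_of_ereal (g z)) = g z" if "g z \<noteq> \<infinity>" for z
    using that ninf[of z] by (cases "g z") auto
  define M where "M = f xs + real_of_ereal (g xs)"
  \<comment> \<open>The gap to the minimum as a real number. It is meaningful only where
    \<open>g\<close> is finite, since \<open>real_of_ereal\<close> sends infinity to 0.\<close>
  define \<Phi> where "\<Phi> z = f z + real_of_ereal (g z) - M" for z
  have F: "F z = ereal (\<Phi> z + M)" if "g z \<noteq> \<infinity>" for z
    using real_g[OF that] assms(8) by (simp add: \<Phi>_def flip: plus_ereal.simps)
  have \<Phi>_xs: "\<Phi> xs = 0" by (simp add: \<Phi>_def M_def)
  have \<Phi>_nonneg: "0 \<le> \<Phi> z" if "g z \<noteq> \<infinity>" for z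
    using xs[of z] F[OF that] F[OF gxs] \<Phi>_xs by simp
  have "min_value F = F xs"
    unfolding min_value_def by (intro antisym INF_lower INF_greatest xs) simp
  then have min_F: "min_value F = ereal M" using F[OF gxs] \<Phi>_xs by simp

  \<comment> \<open>Bounds on the inertial weights and the step sizes\<close>
  have \<beta>_pos: "0 < \<beta> k" if "1 \<le> k" for k using assms(14) that by simp
  have \<beta>_half: "\<beta> k \<le> 1 / 2" if "1 \<le> k" for k
  proof -
    have "(real k + 1) powr 1 \<le> (real k + 1) powr \<theta>"
      using assms(11) by (intro powr_mono) auto
    moreover have "2 \<le> real k + 1" using that by simp
    ultimately have "2 \<le> (real k + 1) powr \<theta>" by simp
    then have "1 / (real k + 1) powr \<theta> \<le> 1 / 2" by (intro divide_left_mono) auto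
    then show ?thesis using assms(14) that by simp
  qed
  have \<beta>_mono: "\<beta> (Suc k) \<le> \<beta> k" if "1 \<le> k" for k
    using assms(11,14) that by (auto intro!: divide_left_mono powr_mono2)
  have "summable (\<lambda>n. real n powr - \<theta>)" using assms(11) by (simp add: summable_real_powr_iff)
  then have "summable (\<lambda>j. real (j + 3) powr - \<theta>)" by (rule summable_ignore_initial_segment)
  then have \<beta>_summable: "summable (\<lambda>j. \<beta> (j + 2))"
    using assms(14) by (simp add: powr_minus_divide add.commute)
  have \<gamma>: "\<gamma> k = 2 * (1 - \<beta> k) * c / L" if "1 \<le> k" for k using assms(15) that by blast
  have \<gamma>_ge: "c / L \<le> \<gamma> k" if "1 \<le> k" for k
  proof -
    have "1 * c \<le> 2 * (1 - \<beta> k) * c" using \<beta>_half[OF that] c by (intro mult_right_mono) auto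
    then show ?thesis using L that by (simp add: \<gamma> divide_right_mono)
  qed
  have \<gamma>_pos: "0 < \<gamma> k" if "1 \<le> k" for k
    using \<gamma>_ge[OF that] c L by (meson divide_pos_pos less_le_trans)
  have \<gamma>_le: "\<gamma> k * L \<le> 2" if "1 \<le> k" for k
  proof -
    have "2 * ((1 - \<beta> k) * c) \<le> 2 * (1 * 1)"
      using \<beta>_pos[OF that] c by (intro mult_left_mono mult_mono) auto
    moreover have "\<gamma> k * L = 2 * ((1 - \<beta> k) * c)" using L that by (simp add: \<gamma>)
    ultimately show ?thesis by simp
  qed

  have x_Suc: "x (Suc k) = prox (\<gamma> k) g (x k - \<gamma> k *\<^sub>R grad_f (x k) + \<beta> k *\<^sub>R (x k - x (k - 1)))"
    if "1 \<le> k" for k using assms(16) that by simp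
  \<comment> \<open>The initial points may lie outside the domain of \<open>g\<close>; finiteness
    holds from index 2 on, where the iterates are proximal points.\<close>
  have fin: "g (x (Suc k)) \<noteq> \<infinity>" if "1 \<le> k" for k
    unfolding x_Suc[OF that] by (rule prox_finite[OF g \<gamma>_pos[OF that]])
  have step: "\<Phi> (x (Suc k)) \<le> \<Phi> z
      + (1 / \<gamma> k) * ((x (Suc k) - x k - \<beta> k *\<^sub>R (x k - x (k - 1))) \<bullet> (z - x (Suc k)))
      + L / 2 * (norm (x (Suc k) - x k))\<^sup>2" if "1 \<le> k" "g z \<noteq> \<infinity>" for k z
    using prox_gradient_step[OF assms(1) grad assms(4) g \<gamma>_pos[OF that(1)] that(2),
        of "x k" "\<beta> k *\<^sub>R (x k - x (k - 1))"]
    by (simp add: x_Suc[OF that(1)] \<Phi>_def)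

  \<comment> \<open>Decrease of the energy and summability of the squared steps\<close>
  define E where "E k = (norm (x (Suc k) - x k))\<^sup>2" for k
  have E_nonneg: "0 \<le> E k" for k by (simp add: E_def)
  define \<delta> where "\<delta> k = \<beta> k / (2 * \<gamma> k)" for k
  have \<delta>_pos: "0 < \<delta> k" if "1 \<le> k" for k
    using \<beta>_pos[OF that] \<gamma>_pos[OF that] by (simp add: \<delta>_def)
  \<comment> \<open>As \<open>\<beta>\<close> decreases, \<open>\<gamma>\<close> increases, so their
    quotient decreases.\<close>
  have \<delta>_mono: "\<delta> (Suc k) \<le> \<delta> k" if "1 \<le> k" for k
    unfolding \<delta>_def
  proof (rule frac_le)
    show "2 * \<gamma> k \<le> 2 * \<gamma> (Suc k)"
      using \<beta>_mono[OF that] that c L by (simp add: \<gamma> divide_right_mono mult_right_mono)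
  qed (use \<beta>_mono \<beta>_pos \<gamma>_pos that in \<open>auto intro: less_imp_le\<close>)
  \<comment> \<open>The index is shifted: \<open>\<xi> k\<close> belongs to the iterate \<open>x (Suc k)\<close>.\<close>
  define \<xi> where "\<xi> k = \<Phi> (x (Suc k)) + \<delta> (Suc k) * E k" for k
  have \<xi>_nonneg: "0 \<le> \<xi> k" if "1 \<le> k" for k
    using \<Phi>_nonneg[OF fin[OF that]] \<delta>_pos[of "Suc k"] E_nonneg[of k] by (simp add: \<xi>_def)

  \<comment> \<open>The choice of \<open>\<gamma>\<close> makes
    \<open>(1 - \<beta> k) / \<gamma> k\<close> equal to \<open>L / (2 * c)\<close>. Of this,
    \<open>L / 2\<close> pays for the smoothness error and \<open>a\<close> is the surplus, positive
    because \<open>c < 1\<close>.\<close>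
  define a where "a = L / 2 * (1 / c - 1)"
  have "a > 0" using L c by (simp add: a_def field_simps)
  have descent: "a * E (Suc k) \<le> \<xi> k - \<xi> (Suc k)" if "1 \<le> k" for k
  proof -
    define e where "e = x (Suc (Suc k)) - x (Suc k)"
    define d where "d = x (Suc k) - x k"
    let ?\<beta> = "\<beta> (Suc k)" and ?\<gamma> = "\<gamma> (Suc k)"
    have [simp]: "0 \<le> ?\<gamma>" "?\<gamma> \<noteq> 0" using \<gamma>_pos[of "Suc k"] by auto
    have "\<Phi> (x (Suc (Suc k))) \<le> \<Phi> (x (Suc k))
        + (1 / ?\<gamma>) * ((e - ?\<beta> *\<^sub>R d) \<bullet> (- e)) + L / 2 * (norm e)\<^sup>2"
      using step[of "Suc k" "x (Suc k)"] fin[OF that] by (simp add: e_def d_def)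
    also have "(e - ?\<beta> *\<^sub>R d) \<bullet> (- e) = ?\<beta> * (d \<bullet> e) - (norm e)\<^sup>2"
      by (simp add: inner_simps power2_norm_eq_inner)
    also have "(1 / ?\<gamma>) * (?\<beta> * (d \<bullet> e) - (norm e)\<^sup>2)
        \<le> (1 / ?\<gamma>) * (?\<beta> * (((norm d)\<^sup>2 + (norm e)\<^sup>2) / 2) - (norm e)\<^sup>2)"
      using \<beta>_pos[of "Suc k"]
      by (intro mult_left_mono diff_right_mono inner_le_half_sum_norms) auto
    \<comment> \<open>Since \<open>\<beta> / \<gamma>\<close> is twice \<open>\<delta>\<close>, the
      coefficient of the squared norm of \<open>e\<close> can be rewritten to isolate
      \<open>- \<delta> (Suc k)\<close>, which moves left as the new energy term.\<close>
    also have "\<dots> = \<delta> (Suc k) * (norm d)\<^sup>2 - \<delta> (Suc k) * (norm e)\<^sup>2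
        - (1 - ?\<beta>) / ?\<gamma> * (norm e)\<^sup>2"
      by (simp add: \<delta>_def field_simps)
    also have "(1 - ?\<beta>) / ?\<gamma> = L / (2 * c)"
      using \<beta>_half[of "Suc k"] c L by (simp add: \<gamma> field_simps)
    also have "L / (2 * c) = a + L / 2" using c by (simp add: a_def field_simps)
    finally have "\<Phi> (x (Suc (Suc k))) \<le> \<Phi> (x (Suc k)) + \<delta> (Suc k) * E k
        - \<delta> (Suc k) * E (Suc k) - a * E (Suc k)"
      by (simp add: E_def e_def d_def algebra_simps)
    moreover have "\<delta> (Suc (Suc k)) * E (Suc k) \<le> \<delta> (Suc k) * E (Suc k)"
      using \<delta>_mono[of "Suc k"] E_nonneg by (intro mult_right_mono) auto
    ultimately show ?thesis by (simp add: \<xi>_def)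
  qed
  have "summable (\<lambda>j. a * E (Suc (Suc j)))"
    using descent \<xi>_nonneg E_nonneg \<open>a > 0\<close>
    by (intro summable_telescope_le[of _ "\<lambda>j. \<xi> (Suc j)"]) auto
  then have "summable (\<lambda>j. E (Suc (Suc j)))" using \<open>a > 0\<close> by simp
  \<comment> \<open>The descent starts at \<open>k = 1\<close> and so controls \<open>E\<close> only
    from index 2; the two initial terms are added back.\<close>
  then have E_summable: "summable E" by (simp only: summable_Suc_iff[of "\<lambda>j. E (Suc j)"] summable_Suc_iff)

  \<comment> \<open>Distance to a minimizer and summability of the gaps\<close>
  have fejer: "(1 - \<beta> k) * (norm (x (Suc k) - xs))\<^sup>2 + 2 * \<gamma> k * \<Phi> (x (Suc k))
      \<le> (norm (x k - xs))\<^sup>2 + (E (k - 1) + E k)" if "2 \<le> k" for k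
  proof -
    have k: "1 \<le> k" "Suc (k - 1) = k" using that by auto
    define p where "p = x (Suc k)"
    define d where "d = x k - x (k - 1)"
    have [simp]: "0 \<le> \<gamma> k" "\<gamma> k \<noteq> 0" using \<gamma>_pos[OF k(1)] by auto
    have "\<Phi> p \<le> (1 / \<gamma> k) * ((p - x k - \<beta> k *\<^sub>R d) \<bullet> (xs - p)) + L / 2 * (norm (p - x k))\<^sup>2"
      using step[OF k(1) gxs] by (simp add: p_def d_def \<Phi>_xs)
    then have "2 * \<gamma> k * \<Phi> p \<le> 2 * \<gamma> k * ((1 / \<gamma> k) * ((p - x k - \<beta> k *\<^sub>R d) \<bullet> (xs - p)) + L / 2 * (norm (p - x k))\<^sup>2)"
      by (intro mult_left_mono) auto
    also have "\<dots> = 2 * ((p - x k) \<bullet> (xs - p)) + 2 * \<beta> k * (d \<bullet> (p - xs)) + \<gamma> k * L * (norm (p - x k))\<^sup>2"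
      by (simp add: inner_simps algebra_simps)
    \<comment> \<open>The three-point identity; its last term later offsets half of the smoothness
      error.\<close>
    also have "2 * ((p - x k) \<bullet> (xs - p)) = (norm (x k - xs))\<^sup>2 - (norm (p - xs))\<^sup>2 - (norm (p - x k))\<^sup>2"
      by (simp add: power2_norm_eq_inner inner_simps inner_commute)
    also have "2 * \<beta> k * (d \<bullet> (p - xs)) \<le> 2 * \<beta> k * (((norm d)\<^sup>2 + (norm (p - xs))\<^sup>2) / 2)"
      using \<beta>_pos[OF k(1)] by (intro mult_left_mono inner_le_half_sum_norms) auto
    \<comment> \<open>Bounding \<open>\<beta> k\<close> by 1 on the old step leaves
      \<open>E (k - 1)\<close>. The factor is kept on the distance term, which moves left and
      produces \<open>1 - \<beta> k\<close>.\<close>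
    also have "\<dots> \<le> (norm d)\<^sup>2 + \<beta> k * (norm (p - xs))\<^sup>2"
      using mult_right_mono[of "\<beta> k" 1 "(norm d)\<^sup>2"] \<beta>_half[OF k(1)] by (simp add: algebra_simps)
    also have "\<gamma> k * L * (norm (p - x k))\<^sup>2 \<le> 2 * (norm (p - x k))\<^sup>2"
      using \<gamma>_le[OF k(1)] by (intro mult_right_mono) auto
    finally show ?thesis using k(2) by (simp add: E_def p_def d_def algebra_simps)
  qed
  have "summable (\<lambda>j. 2 * \<gamma> (j + 2) * \<Phi> (x (Suc (j + 2))))"
  proof (rule summable_quasi_Fejer[where b = "\<lambda>j. \<beta> (j + 2)" and s = "\<lambda>j. E (j + 1) + E (j + 2)"
        and u = "\<lambda>j. (norm (x (j + 2) - xs))\<^sup>2"])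
    show "summable (\<lambda>j. \<beta> (j + 2))" by fact
    show "summable (\<lambda>j. E (j + 1) + E (j + 2))"
      using E_summable by (intro summable_add summable_ignore_initial_segment)
    show "(1 - \<beta> (j + 2)) * (norm (x (Suc j + 2) - xs))\<^sup>2 + 2 * \<gamma> (j + 2) * \<Phi> (x (Suc (j + 2)))
      \<le> (norm (x (j + 2) - xs))\<^sup>2 + (E (j + 1) + E (j + 2))" for j
      using fejer[of "j + 2"] by simp
    show "0 \<le> 2 * \<gamma> (j + 2) * \<Phi> (x (Suc (j + 2)))" for j
      using \<gamma>_pos[of "j + 2"] \<Phi>_nonneg[OF fin, of "j + 2"] by simp
    show "0 \<le> \<beta> (j + 2)" for j using \<beta>_pos[of "j + 2"] by simp
    show "\<beta> (j + 2) \<le> 1 / 2" for j using \<beta>_half[of "j + 2"] by simp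
    show "0 \<le> E (j + 1) + E (j + 2)" for j using E_nonneg by simp
  qed simp
  \<comment> \<open>The uniform lower bound \<open>c / L\<close> on the step sizes removes them from
    the summable series.\<close>
  then have "summable (\<lambda>j. 2 * (c / L) * \<Phi> (x (Suc (j + 2))))"
  proof (rule summable_comparison_test'[where N = 0])
    fix j
    have "0 \<le> \<Phi> (x (Suc (j + 2)))" using fin[of "j + 2"] by (intro \<Phi>_nonneg) simp
    then show "norm (2 * (c / L) * \<Phi> (x (Suc (j + 2)))) \<le> 2 * \<gamma> (j + 2) * \<Phi> (x (Suc (j + 2)))"
      using \<gamma>_ge[of "j + 2"] c L by (simp add: mult_right_mono abs_mult del: times_divide_eq_right)
  qed
  then have \<Phi>_summable: "summable (\<lambda>j. \<Phi> (x (Suc (j + 2))))"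
    by (rule summable_mult_D) (use c L in simp)

  \<comment> \<open>From a decreasing summable energy to the rate\<close>
  define v where "v j = \<xi> (j + 2)" for j
  have v_nonneg: "0 \<le> v j" for j using \<xi>_nonneg[of "j + 2"] by (simp add: v_def)
  have "decseq v"
  proof (rule decseq_SucI)
    fix j
    have "0 \<le> a * E (Suc (j + 2))" using \<open>a > 0\<close> E_nonneg by simp
    then show "v (Suc j) \<le> v j" using descent[of "j + 2"] by (simp add: v_def)
  qed
  have \<delta>_le: "\<delta> (Suc k) \<le> \<delta> 1" for k
  proof (induction k)
    case (Suc k)
    then show ?case using \<delta>_mono[of "Suc k"] by simp
  qed simp
  have "summable (\<lambda>j. \<delta> (Suc (j + 2)) * E (j + 2))"
  proof (rule summable_comparison_test'[where N = 0])
    show "summable (\<lambda>j. \<delta> 1 * E (j + 2))"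
      using E_summable by (intro summable_mult summable_ignore_initial_segment)
    fix j
    show "norm (\<delta> (Suc (j + 2)) * E (j + 2)) \<le> \<delta> 1 * E (j + 2)"
      using \<delta>_pos[of "Suc (j + 2)"] E_nonneg[of "j + 2"] \<delta>_le[of "j + 2"]
      by (simp add: abs_mult mult_right_mono)
  qed
  then have "summable v" unfolding v_def \<xi>_def by (intro summable_add \<Phi>_summable)
  have rate: "\<bar>\<Phi> (x k)\<bar> \<le> 4 * suminf v * (1 / real k)" if "4 \<le> k" for k
  proof -
    \<comment> \<open>\<open>v j\<close> contains the gap at \<open>x (j + 3)\<close>. For
      \<open>k \<ge> 4\<close> one has \<open>j \<ge> 1\<close>, hence
      \<open>k = j + 3 \<le> 4 * j\<close>, which explains the factor 4.\<close>
    define j where "j = k - 3"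
    have j: "k = Suc (j + 2)" "1 \<le> j" using that by (auto simp: j_def)
    have "0 \<le> \<Phi> (x k)" unfolding j(1) by (intro \<Phi>_nonneg fin) simp
    have "\<Phi> (x k) \<le> v j"
      using \<delta>_pos[of k] E_nonneg[of "j + 2"] that by (simp add: v_def \<xi>_def j(1))
    then have "real k * \<Phi> (x k) \<le> (4 * real j) * v j"
      using j v_nonneg[of j] \<open>0 \<le> \<Phi> (x k)\<close> by (intro mult_mono) auto
    also have "\<dots> \<le> 4 * suminf v"
      using decseq_summable_bound[OF \<open>decseq v\<close> v_nonneg \<open>summable v\<close>, of j] by simp
    finally show ?thesis using that \<open>0 \<le> \<Phi> (x k)\<close> by (simp add: field_simps)
  qed
  have fin': "g (x k) \<noteq> \<infinity>" if "2 \<le> k" for k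
    using fin[of "k - 1"] that by (simp add: Suc_diff_Suc numeral_2_eq_2)
  show ?thesis
  proof
    show "\<forall>\<^sub>F k in sequentially. F (x k) \<noteq> \<infinity>"
      using eventually_ge_at_top[of 2] by eventually_elim (simp add: F fin')
    show "(\<lambda>k. real_of_ereal (F (x k) - min_value F)) \<in> O(\<lambda>k. 1 / real k)"
    proof (rule bigoI)
      show "\<forall>\<^sub>F k in sequentially.
          norm (real_of_ereal (F (x k) - min_value F)) \<le> 4 * suminf v * norm (1 / real k)"
        using eventually_ge_at_top[of 4]
      proof eventually_elim
        case (elim k)
        then show ?case using rate[of k] F[OF fin', of k] by (simp add: min_F)
      qed
    qed
  qed
qed

end
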